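(* The fragment $\mathcal{H}^c$ is reducible to $\mathcal{H}^c_{\infty,2}$.
   Context: Clauses and fragments. - Clauses are function-free second-order Horn clauses: a head (at most one positive literal) and a finite body of negative literals. Each literal is a predicate variable of arity in $\mathbb{N}^*$ applied to term variables. - The body size $|C|$ is the number of body literals. - A clause is connected if its literals cannot be partitioned into two non-empty sets with disjoint sets of variables. $\mathcal{H}^c$ is the set of all connected clauses. - $\mathcal{F}_{a,b}$ denotes the clauses of $\mathcal{F}$ with all literal arities at most $a$ and body size at most $b$; $\infty$ means no bound. - Fragments are considered modulo variable renaming and contain only the most general clauses up to variable unification; inferences are taken modulo variable unification. SLD-resolution. - Substitutions map term variables to term variables and predicate variables to predicate variables of the same arity. - An SLD-resolution inference $C_1,C_2\vdash C$ is binary resolution without factoring: a body literal of one premise is unified by a most general unifier with the head of the other, and the resolvent consists of the remaining literals with the unifier applied. Reducibility. A fragment $\mathcal{F}$ is reducible to $\mathcal{F}_{\infty,b}$ if, for every $C\in\mathcal{F}$ with $b<|C|$, there exists $b'<|C|$ such that $C$ is the resolvent of an SLD-inference whose premises lie in $\mathcal{F}_{\infty,b'}$. *)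

theory Defs
  imports Main "HOL-Library.Multiset" "HOL-Library.Extended_Nat"
begin

datatype pvar = PVar (pname: nat) (arity: nat)

type_synonym tvar = nat

datatype lit = Lit (pred: pvar) (args: "tvar list")

text \<open>Bodies are multisets: resolution is without factoring, so literals that become equal under
  a substitution are not merged, and unifying variables preserves the body size.\<close>

datatype clause = Clause (head: "lit option") (body: "lit multiset")

definition lits :: "clause \<Rightarrow> lit multiset" where
  "lits C = (case head C of None \<Rightarrow> {#} | Some H \<Rightarrow> {#H#}) + body C"

definition body_size :: "clause \<Rightarrow> nat" where
  "body_size C = size (body C)"

definition wf_lit :: "lit \<Rightarrow> bool" where
  "wf_lit L \<longleftrightarrow> 0 < arity (pred L) \<and> length (args L) = arity (pred L)"

definition wf_clause :: "clause \<Rightarrow> bool" where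
  "wf_clause C \<longleftrightarrow> (\<forall>L \<in># lits C. wf_lit L)"

definition tvars :: "lit multiset \<Rightarrow> tvar set" where
  "tvars M = (\<Union>L \<in> set_mset M. set (args L))"

definition pvars :: "lit multiset \<Rightarrow> pvar set" where
  "pvars M = pred ` set_mset M"

text \<open>Connectedness refers to term variables only; sharing a predicate variable does not
  connect two literals.\<close>

definition connected_clause :: "clause \<Rightarrow> bool" where
  "connected_clause C \<longleftrightarrow>
     \<not> (\<exists>A B. A \<noteq> {#} \<and> B \<noteq> {#} \<and> lits C = A + B \<and> tvars A \<inter> tvars B = {})"

definition Hc :: "clause set" where
  "Hc = {C. wf_clause C \<and> connected_clause C}"

type_synonym subst = "(pvar \<Rightarrow> pvar) \<times> (tvar \<Rightarrow> tvar)"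

definition is_subst :: "subst \<Rightarrow> bool" where
  "is_subst \<sigma> \<longleftrightarrow> (\<forall>P. arity (fst \<sigma> P) = arity P)"

definition is_renaming :: "subst \<Rightarrow> bool" where
  "is_renaming \<sigma> \<longleftrightarrow> is_subst \<sigma> \<and> bij (fst \<sigma>) \<and> bij (snd \<sigma>)"

definition subst_comp :: "subst \<Rightarrow> subst \<Rightarrow> subst" where
  "subst_comp \<rho> \<sigma> = (fst \<rho> \<circ> fst \<sigma>, snd \<rho> \<circ> snd \<sigma>)"

definition subst_lit :: "subst \<Rightarrow> lit \<Rightarrow> lit" where
  "subst_lit \<sigma> L = Lit (fst \<sigma> (pred L)) (map (snd \<sigma>) (args L))"

definition subst_clause :: "subst \<Rightarrow> clause \<Rightarrow> clause" where
  "subst_clause \<sigma> C =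
     Clause (map_option (subst_lit \<sigma>) (head C)) (image_mset (subst_lit \<sigma>) (body C))"

definition instance_of :: "clause \<Rightarrow> clause \<Rightarrow> bool" where
  "instance_of C D \<longleftrightarrow> (\<exists>\<sigma>. is_subst \<sigma> \<and> C = subst_clause \<sigma> D)"

definition variant_of :: "clause \<Rightarrow> clause \<Rightarrow> bool" where
  "variant_of C D \<longleftrightarrow> (\<exists>\<sigma>. is_renaming \<sigma> \<and> C = subst_clause \<sigma> D)"

definition most_general :: "clause set \<Rightarrow> clause set" where
  "most_general F = {C \<in> F. \<forall>D \<in> F. instance_of C D \<longrightarrow> variant_of D C}"

definition bounded_fragment :: "clause set \<Rightarrow> enat \<Rightarrow> enat \<Rightarrow> clause set" where
  "bounded_fragment F a b =
     {C \<in> F. (\<forall>L \<in># lits C. enat (arity (pred L)) \<le> a) \<and> enat (body_size C) \<le> b}"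

definition is_unifier :: "subst \<Rightarrow> lit \<Rightarrow> lit \<Rightarrow> bool" where
  "is_unifier \<sigma> L M \<longleftrightarrow> is_subst \<sigma> \<and> subst_lit \<sigma> L = subst_lit \<sigma> M"

definition is_mgu :: "subst \<Rightarrow> lit \<Rightarrow> lit \<Rightarrow> bool" where
  "is_mgu \<sigma> L M \<longleftrightarrow> is_unifier \<sigma> L M \<and>
     (\<forall>\<theta>. is_unifier \<theta> L M \<longrightarrow> (\<exists>\<rho>. is_subst \<rho> \<and> \<theta> = subst_comp \<rho> \<sigma>))"

definition vars_disjoint :: "clause \<Rightarrow> clause \<Rightarrow> bool" where
  "vars_disjoint C D \<longleftrightarrow>
     tvars (lits C) \<inter> tvars (lits D) = {} \<and> pvars (lits C) \<inter> pvars (lits D) = {}"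

definition resolvent_on_body_of_first :: "clause \<Rightarrow> clause \<Rightarrow> clause \<Rightarrow> bool" where
  "resolvent_on_body_of_first C\<^sub>1 C\<^sub>2 C \<longleftrightarrow>
     (\<exists>L H \<sigma>. L \<in># body C\<^sub>1 \<and> head C\<^sub>2 = Some H \<and> is_mgu \<sigma> L H \<and>
        C = subst_clause \<sigma> (Clause (head C\<^sub>1) ((body C\<^sub>1 - {#L#}) + body C\<^sub>2)))"

definition sld_resolvent :: "clause \<Rightarrow> clause \<Rightarrow> clause \<Rightarrow> bool" where
  "sld_resolvent C\<^sub>1 C\<^sub>2 C \<longleftrightarrow> vars_disjoint C\<^sub>1 C\<^sub>2 \<and>
     (resolvent_on_body_of_first C\<^sub>1 C\<^sub>2 C \<or> resolvent_on_body_of_first C\<^sub>2 C\<^sub>1 C)"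

text \<open>Inference modulo variable unification: variables inside each premise may be unified (and
  renamed, to keep the premises variable-disjoint) before resolving. The conclusion is the
  resolvent up to renaming only; it may not be specialised further.\<close>

definition sld_inference :: "clause \<Rightarrow> clause \<Rightarrow> clause \<Rightarrow> bool" where
  "sld_inference C\<^sub>1 C\<^sub>2 C \<longleftrightarrow>
     (\<exists>D\<^sub>1 D\<^sub>2 D. instance_of D\<^sub>1 C\<^sub>1 \<and> instance_of D\<^sub>2 C\<^sub>2 \<and> sld_resolvent D\<^sub>1 D\<^sub>2 D \<and> variant_of C D)"

definition reducible :: "clause set \<Rightarrow> nat \<Rightarrow> bool" where
  "reducible F b \<longleftrightarrow>
     (\<forall>C \<in> F. b < body_size C \<longrightarrow>
        (\<exists>b' < body_size C.
           \<exists>C\<^sub>1 \<in> bounded_fragment F \<infinity> (enat b'). \<exists>C\<^sub>2 \<in> bounded_fragment F \<infinity> (enat b').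
             sld_inference C\<^sub>1 C\<^sub>2 C))"

end

theory Submission
  imports Defs "HOL-Combinatorics.Transposition"
begin

text \<open>Let \<open>C = H \<leftarrow> L\<^sub>1, L\<^sub>2, R\<close> be most general with \<open>R\<close> nonempty, and let \<open>xs\<close> list all
  term variables of \<open>C\<close>. With a fresh predicate variable \<open>P\<close>, the clause \<open>C\<close> is the resolvent of
  \<open>H \<leftarrow> P(xs), R\<close> and a renamed copy of \<open>P(xs) \<leftarrow> L\<^sub>1, L\<^sub>2\<close>. Both premises are connected, because one
  of their literals contains every term variable. They need not be most general, but each is an
  instance of a most general connected clause of the same body size: among all generalizations
  choose one with the largest number of variables. Most generality of \<open>C\<close> is needed
  only to see that the predicate variables of \<open>L\<^sub>1\<close> and \<open>L\<^sub>2\<close> do not occur elsewhere in \<open>C\<close>, so that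
  the two premises can be made variable-disjoint.\<close>

section \<open>Substitutions acting on clauses and on their variables\<close>

lemma lits_subst_clause: "lits (subst_clause \<sigma> C) = image_mset (subst_lit \<sigma>) (lits C)"
  by (cases "head C") (auto simp: lits_def subst_clause_def)

lemma body_size_subst_clause [simp]: "body_size (subst_clause \<sigma> C) = body_size C"
  by (simp add: body_size_def subst_clause_def)

lemma tvars_subst: "tvars (image_mset (subst_lit \<sigma>) M) = snd \<sigma> ` tvars M"
  by (auto simp: tvars_def subst_lit_def)

lemma pvars_subst: "pvars (image_mset (subst_lit \<sigma>) M) = fst \<sigma> ` pvars M"
  by (force simp: pvars_def subst_lit_def)

lemma finite_tvars [simp]: "finite (tvars M)"
  by (simp add: tvars_def)

lemma finite_pvars [simp]: "finite (pvars M)"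
  by (simp add: pvars_def)

lemma tvars_add_mset [simp]: "tvars (add_mset L M) = set (args L) \<union> tvars M"
  by (simp add: tvars_def)

lemma pvars_add_mset [simp]: "pvars (add_mset L M) = insert (pred L) (pvars M)"
  by (simp add: pvars_def)

lemma lits_add_body [simp]: "lits (Clause h (add_mset L M)) = add_mset L (lits (Clause h M))"
  by (simp add: lits_def)

lemma lits_Some [simp]: "lits (Clause (Some H) M) = add_mset H M"
  by (simp add: lits_def)

lemma subst_lit_cong:
  assumes "fst \<sigma> (pred L) = fst \<tau> (pred L)"
    and "\<And>v. v \<in> set (args L) \<Longrightarrow> snd \<sigma> v = snd \<tau> v"
  shows "subst_lit \<sigma> L = subst_lit \<tau> L"
  using assms by (simp add: subst_lit_def)

lemma subst_clause_cong:
  assumes "\<And>P. P \<in> pvars (lits C) \<Longrightarrow> fst \<sigma> P = fst \<tau> P"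
    and "\<And>v. v \<in> tvars (lits C) \<Longrightarrow> snd \<sigma> v = snd \<tau> v"
  shows "subst_clause \<sigma> C = subst_clause \<tau> C"
proof -
  have eq: "subst_lit \<sigma> L = subst_lit \<tau> L" if "L \<in># lits C" for L
    using that assms by (intro subst_lit_cong) (auto simp: pvars_def tvars_def)
  show ?thesis
    using eq by (cases "head C") (auto simp: subst_clause_def lits_def intro: image_mset_cong)
qed

lemma subst_clause_comp: "subst_clause \<rho> (subst_clause \<sigma> C) = subst_clause (subst_comp \<rho> \<sigma>) C"
  by (cases "head C")
    (auto simp: subst_clause_def subst_lit_def subst_comp_def multiset.map_comp intro: image_mset_cong)

lemma subst_clause_id [simp]: "subst_clause (id, id) C = C"
proof -
  have "subst_lit (id, id) = id"
    by (auto simp: subst_lit_def)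
  then show ?thesis
    by (cases C) (simp add: subst_clause_def option.map_id)
qed

lemma variant_of_refl: "variant_of C C"
  unfolding variant_of_def
  by (rule exI[of _ "(id, id)"]) (simp add: is_renaming_def is_subst_def)

lemma instance_of_refl: "instance_of C C"
  unfolding instance_of_def
  by (rule exI[of _ "(id, id)"]) (simp add: is_subst_def)

lemma instance_of_trans: "instance_of C D \<Longrightarrow> instance_of D E \<Longrightarrow> instance_of C E"
  unfolding instance_of_def
  by (metis (no_types, lifting) comp_apply fst_conv is_subst_def subst_clause_comp subst_comp_def)

lemma body_size_instance_of: "instance_of C D \<Longrightarrow> body_size C = body_size D"
  by (auto simp: instance_of_def)

section \<open>Variants, variable counts and most general clauses\<close>

text \<open>A renaming must be bijective on all variables, while a substitution is controlled only
  on the finitely many variables of a clause. The invariant \<open>k\<close> stands for the arity of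
  predicate variables and is constant for term variables.\<close>

lemma inj_on_extend_bij:
  assumes "finite A" "inj_on f A" "\<And>x. x \<in> A \<Longrightarrow> k (f x) = k x"
  shows "\<exists>g. bij g \<and> (\<forall>x\<in>A. g x = f x) \<and> (\<forall>x. k (g x) = k x)"
  using assms
proof (induction A)
  case empty
  show ?case by (rule exI[of _ id]) (simp add: bij_def)
next
  case (insert a A)
  then obtain g where g: "bij g" "\<forall>x\<in>A. g x = f x" "\<forall>x. k (g x) = k x"
    by auto
  \<comment> \<open>The transposition redirects \<open>a\<close> to \<open>f a\<close>. On
    \<open>A\<close> nothing changes, since there \<open>g x = f x\<close> differs from both swapped
    points, and \<open>k\<close> survives because \<open>g a\<close> and \<open>f a\<close> share
    the value \<open>k a\<close>.\<close>
  define g' where "g' = transpose (g a) (f a) \<circ> g"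
  have "bij g'"
    unfolding g'_def using g(1) by (simp add: bij_comp)
  moreover have "g' x = f x" if "x \<in> insert a A" for x
  proof (cases "x = a")
    case False
    with that have "x \<in> A" by simp
    then have "g x = f x" "f x \<noteq> f a"
      using g(2) insert.prems(1) insert.hyps(2) by (simp_all, metis imageI)
    moreover have "g x \<noteq> g a"
      using False g(1) by (simp add: bij_is_inj inj_eq)
    ultimately show ?thesis by (simp add: g'_def)
  qed (simp add: g'_def)
  moreover have "k (g' x) = k x" for x
    using g(3) insert.prems(2)[of a] by (simp add: g'_def transpose_def) metis
  ultimately show ?case by blast
qed

text \<open>This measures generality: passing to an instance never increases it, and it stays equal
  only for variants.\<close>

definition num_vars :: "clause \<Rightarrow> nat" where
  "num_vars C = card (tvars (lits C)) + card (pvars (lits C))"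

lemma card_tvars_le: "card (tvars M) \<le> (\<Sum>L\<in>#M. length (args L))"
proof (induction M)
  case (add L M)
  have "card (tvars (add_mset L M)) \<le> card (set (args L)) + card (tvars M)"
    by (simp add: card_Un_le)
  also have "\<dots> \<le> length (args L) + (\<Sum>L\<in>#M. length (args L))"
    using add card_length by (rule add_mono[rotated])
  finally show ?case by simp
qed (simp add: tvars_def)

lemma card_pvars_le: "card (pvars M) \<le> size M"
proof (induction M)
  case (add L M)
  then show ?case
    using card_insert_le_m1[of "size M + 1" "pvars M" "pred L"] by simp
qed (simp add: pvars_def)

text \<open>Each argument position carries one term variable and each literal one predicate
  variable, and substitutions preserve both numbers. The bound depends on \<open>C\<close> alone, so
  a generalization with the most variables exists.\<close>

lemma num_vars_instance_bound:
  assumes "instance_of C D"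
  shows "num_vars D \<le> (\<Sum>L\<in>#lits C. length (args L)) + size (lits C)"
proof -
  obtain \<sigma> where "C = subst_clause \<sigma> D"
    using assms by (auto simp: instance_of_def)
  then have "lits C = image_mset (subst_lit \<sigma>) (lits D)"
    by (simp add: lits_subst_clause)
  then have "(\<Sum>L\<in>#lits C. length (args L)) = (\<Sum>L\<in>#lits D. length (args L))"
    "size (lits C) = size (lits D)"
    by (simp_all add: multiset.map_comp comp_def subst_lit_def)
  then show ?thesis
    using card_tvars_le[of "lits D"] card_pvars_le[of "lits D"] by (simp add: num_vars_def)
qed

text \<open>The substitution maps the variables of \<open>D\<close> onto those of \<open>C\<close>,
  so neither count can grow and the hypothesis forces both to agree. It is then injective on
  \<open>D\<close>, and the inverse of a bijective extension leads back from \<open>C\<close> to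
  \<open>D\<close>.\<close>

lemma variant_of_if_num_vars_le:
  assumes "instance_of C D" "num_vars D \<le> num_vars C"
  shows "variant_of D C"
proof -
  obtain \<sigma> where \<sigma>: "is_subst \<sigma>" "C = subst_clause \<sigma> D"
    using assms(1) by (auto simp: instance_of_def)
  have T: "tvars (lits C) = snd \<sigma> ` tvars (lits D)" and P: "pvars (lits C) = fst \<sigma> ` pvars (lits D)"
    by (simp_all add: \<sigma>(2) lits_subst_clause tvars_subst pvars_subst)
  have "card (tvars (lits C)) \<le> card (tvars (lits D))" "card (pvars (lits C)) \<le> card (pvars (lits D))"
    by (simp_all add: T P card_image_le)
  with assms(2) have "card (tvars (lits C)) = card (tvars (lits D))"
    "card (pvars (lits C)) = card (pvars (lits D))"
    by (simp_all add: num_vars_def)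
  then have inj: "inj_on (snd \<sigma>) (tvars (lits D))" "inj_on (fst \<sigma>) (pvars (lits D))"
    by (simp_all add: T P eq_card_imp_inj_on)
  obtain g where g: "bij g" "\<forall>x\<in>tvars (lits D). g x = snd \<sigma> x"
    using inj_on_extend_bij[OF _ inj(1), of "\<lambda>_. ()"] by auto
  obtain h where h: "bij h" "\<forall>x\<in>pvars (lits D). h x = fst \<sigma> x" "\<forall>x. arity (h x) = arity x"
    using inj_on_extend_bij[OF _ inj(2), of arity] \<sigma>(1) by (auto simp: is_subst_def)
  have C: "C = subst_clause (h, g) D"
    unfolding \<sigma>(2) using g h by (intro subst_clause_cong) auto
  have "inv h \<circ> h = id" "inv g \<circ> g = id"
    using g(1) h(1) by (simp_all add: bij_is_inj)
  then have "D = subst_clause (inv h, inv g) C"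
    by (simp add: C subst_clause_comp subst_comp_def)
  moreover have "arity (inv h P) = arity P" for P
    using h by (metis bij_inv_eq_iff)
  then have "is_renaming (inv h, inv g)"
    using g(1) h(1) by (simp add: is_renaming_def is_subst_def bij_imp_bij_inv)
  ultimately show ?thesis
    unfolding variant_of_def by blast
qed

lemma exists_most_general:
  assumes "C \<in> F"
  obtains G where "G \<in> most_general F" "instance_of C G"
proof -
  let ?Q = "\<lambda>G. G \<in> F \<and> instance_of C G"
  obtain G where G: "?Q G" "\<And>D. ?Q D \<Longrightarrow> num_vars D \<le> num_vars G"
    using ex_has_greatest_nat[of ?Q C num_vars "Suc ((\<Sum>L\<in>#lits C. length (args L)) + size (lits C))"]
      assms instance_of_refl num_vars_instance_bound by (metis less_Suc_eq_le)
  have "G \<in> most_general F"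
    unfolding most_general_def using G by (blast intro: variant_of_if_num_vars_le instance_of_trans)
  with G(1) that show thesis by blast
qed

section \<open>Criteria for connectedness\<close>

text \<open>In a partition the part containing \<open>P\<close> has all the variables, which leaves
  none for the other part. Yet every literal has positive arity, so a nonempty part has a
  variable.\<close>

lemma connected_clause_if_covering_literal:
  assumes "wf_clause C" "P \<in># lits C" "tvars (lits C) \<subseteq> set (args P)"
  shows "connected_clause C"
  unfolding connected_clause_def
proof clarify
  fix A B
  assume A: "A \<noteq> {#}" and B: "B \<noteq> {#}" and AB: "lits C = A + B" and disj: "tvars A \<inter> tvars B = {}"
  have tv: "tvars (lits C) = tvars A \<union> tvars B"
    by (simp add: AB tvars_def)
  have ne: "tvars M \<noteq> {}" if M: "M \<noteq> {#}" "M \<subseteq># lits C" for M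
  proof -
    obtain L where "L \<in># M" using M(1) by blast
    moreover from this have "wf_lit L"
      using M(2) assms(1) by (auto simp: wf_clause_def dest: mset_subset_eqD)
    ultimately show ?thesis
      by (fastforce simp: tvars_def wf_lit_def)
  qed
  have "tvars A \<noteq> {}" "tvars B \<noteq> {}"
    using ne A B by (simp_all add: AB)
  moreover have "set (args P) \<subseteq> tvars A \<or> set (args P) \<subseteq> tvars B"
    using assms(2) by (auto simp: AB tvars_def)
  ultimately show False
    using assms(3) disj tv by blast
qed

text \<open>Changing predicate variables alone carries a partition of \<open>D\<close> to one of the
  instance with the same term variables.\<close>

lemma connected_clause_if_connected_pred_instance:
  assumes "connected_clause (subst_clause (f, id) D)"
  shows "connected_clause D"
  unfolding connected_clause_def
proof clarify
  fix A B
  assume "A \<noteq> {#}" "B \<noteq> {#}" "lits D = A + B" "tvars A \<inter> tvars B = {}"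
  then have "\<exists>A B. A \<noteq> {#} \<and> B \<noteq> {#} \<and> lits (subst_clause (f, id) D) = A + B \<and> tvars A \<inter> tvars B = {}"
    by (intro exI[of _ "image_mset (subst_lit (f, id)) _"]) (simp add: lits_subst_clause tvars_subst)
  with assms show False
    unfolding connected_clause_def by contradiction
qed

section \<open>Fresh predicate variables\<close>

lemma exists_fresh_pvar:
  assumes "finite S"
  obtains P where "arity P = n" "P \<notin> S"
proof -
  have "infinite (range (\<lambda>i. PVar i n))"
    by (rule range_inj_infinite) (simp add: inj_def)
  then obtain P where "P \<in> range (\<lambda>i. PVar i n)" "P \<notin> S"
    using assms by (meson rev_finite_subset subsetI)
  with that[of P] show thesis by auto
qed

text \<open>If the predicate variable of \<open>L\<close> occurred elsewhere, a fresh
  \<open>Q\<close> in its place in \<open>L\<close> alone would give a connected generalization with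
  one more predicate variable, which is not a variant.\<close>

lemma most_general_Hc_pred_unique:
  assumes mg: "Clause h (add_mset L R) \<in> most_general Hc"
  shows "pred L \<notin> pvars (lits (Clause h R))"
proof
  let ?C = "Clause h (add_mset L R)" and ?M = "lits (Clause h R)"
  assume mem: "pred L \<in> pvars ?M"
  obtain Q where Q: "arity Q = arity (pred L)" "Q \<notin> pvars (lits ?C)"
    using exists_fresh_pvar[OF finite_pvars] .
  define D where "D = Clause h (add_mset (Lit Q (args L)) R)"
  let ?\<sigma> = "(id(Q := pred L), id) :: subst"
  have id: "subst_clause ?\<sigma> (Clause h R) = Clause h R"
    using Q(2) by (subst subst_clause_cong[of _ _ "(id, id)"]) auto
  then have inst: "?C = subst_clause ?\<sigma> D"
    by (simp add: D_def subst_clause_def) (simp add: subst_lit_def)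
  have "is_subst ?\<sigma>"
    using Q(1) by (simp add: is_subst_def)
  with inst have "instance_of ?C D"
    unfolding instance_of_def by blast
  moreover have "wf_clause ?C" "connected_clause ?C"
    using mg by (simp_all add: most_general_def Hc_def)
  then have "D \<in> Hc"
    using Q(1) connected_clause_if_connected_pred_instance[of "id(Q := pred L)" D]
    by (simp add: Hc_def flip: inst) (simp add: D_def wf_clause_def wf_lit_def)
  ultimately obtain \<rho> where "is_renaming \<rho>" "D = subst_clause \<rho> ?C"
    using mg by (auto simp: most_general_def variant_of_def)
  then have "card (pvars (lits D)) \<le> card (pvars (lits ?C))"
    by (simp only: lits_subst_clause pvars_subst card_image_le finite_pvars)
  then show False
    using mem Q(2) by (simp add: D_def insert_absorb)
qed

section \<open>Splitting off a block of body literals by resolution\<close>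

lemma is_mgu_if_idempotent:
  assumes "is_unifier \<sigma> L M"
    and "\<And>\<theta>. is_unifier \<theta> L M \<Longrightarrow> subst_comp \<theta> \<sigma> = \<theta>"
  shows "is_mgu \<sigma> L M"
  using assms unfolding is_mgu_def by (metis is_unifier_def)

text \<open>The unifier can restore renamed term variables because \<open>xs\<close> lists them all,
  but not renamed predicate variables of \<open>B\<close>. These keep their names, and
  \<open>disj\<close> lets the premises still be variable-disjoint.\<close>

lemma sld_resolvent_split:
  assumes C: "Clause h (B + R) \<in> Hc" and disj: "pvars B \<inter> pvars (lits (Clause h R)) = {}"
    and ne: "B \<noteq> {#}"
  obtains D1 D2 where "D1 \<in> Hc" "D2 \<in> Hc" "sld_resolvent D1 D2 (Clause h (B + R))"
    "body_size D1 = Suc (size R)" "body_size D2 = size B"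
proof -
  let ?C = "Clause h (B + R)"
  have litsC: "lits ?C = B + lits (Clause h R)"
    by (simp add: lits_def)
  have wf: "wf_lit L" if "L \<in># lits ?C" for L
    using C that by (simp add: Hc_def wf_clause_def)
  define X where "X = tvars (lits ?C)"
  have X: "finite X" "tvars B \<subseteq> X" "tvars (lits (Clause h R)) \<subseteq> X"
    by (auto simp: X_def litsC tvars_def)
  define xs where "xs = sorted_list_of_set X"
  have set_xs: "set xs = X"
    using X(1) by (simp add: xs_def)
  \<comment> \<open>Arities are positive, so the new literal needs an argument; a literal of
    \<open>B\<close> supplies one.\<close>
  obtain L where L: "L \<in># B" using ne by blast
  with wf[of L] have "args L \<noteq> []"
    by (auto simp: litsC wf_lit_def)
  with L X(2) have "X \<noteq> {}"
    by (fastforce simp: tvars_def)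
  then have len: "0 < length xs"
    using set_xs by auto
  obtain P where P: "arity P = length xs" "P \<notin> pvars (lits ?C)"
    using exists_fresh_pvar[OF finite_pvars] .
  \<comment> \<open>The premises may not share even the predicate variable resolved upon, hence a
    second fresh one for \<open>D2\<close>.\<close>
  obtain P' where P': "arity P' = length xs" "P' \<notin> insert P (pvars (lits ?C))"
    using exists_fresh_pvar[of "insert P (pvars (lits ?C))"] by auto
  \<comment> \<open>Shifting by more than \<open>Max X\<close> moves every variable of
    \<open>X\<close> out of \<open>X\<close>.\<close>
  define N where "N = Suc (Max X)"
  have N: "x < N" if "x \<in> X" for x
    using that X(1) by (simp add: N_def less_Suc_eq_le)
  define \<delta> where "\<delta> = (id :: pvar \<Rightarrow> pvar, \<lambda>x. x + N)"
  \<comment> \<open>This undoes the shift on the copied variables, where the subtraction is exact,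
    and identifies \<open>P'\<close> with \<open>P\<close>.\<close>
  define \<sigma> where "\<sigma> = (id(P' := P), \<lambda>v. if v \<in> (\<lambda>x. x + N) ` X then v - N else v)"
  define K where "K = Lit P xs"
  define K' where "K' = Lit P' (map (\<lambda>x. x + N) xs)"
  define D1 where "D1 = Clause h (add_mset K R)"
  define D2 where "D2 = Clause (Some K') (image_mset (subst_lit \<delta>) B)"
  have pv: "P' \<notin> pvars B" "P \<notin> pvars B" "P' \<notin> pvars (lits (Clause h R))" "P' \<noteq> P"
    "P \<notin> pvars (lits (Clause h R))"
    using P(2) P'(2) by (auto simp: litsC pvars_def)
  have "wf_clause D1"
    using wf P(1) len by (auto simp: wf_clause_def D1_def K_def wf_lit_def litsC)
  moreover have "connected_clause D1"
    using X(3) set_xs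
    by (intro connected_clause_if_covering_literal[OF \<open>wf_clause D1\<close>, of K]) (auto simp: D1_def K_def)
  ultimately have D1: "D1 \<in> Hc"
    by (simp add: Hc_def)
  have tv2: "tvars (lits D2) \<subseteq> (\<lambda>x. x + N) ` X"
    using X(2) set_xs by (auto simp: D2_def tvars_subst K'_def \<delta>_def)
  have "wf_clause D2"
    using wf P'(1) len by (auto simp: wf_clause_def D2_def K'_def wf_lit_def litsC \<delta>_def subst_lit_def)
  moreover have "connected_clause D2"
    using tv2 set_xs
    by (intro connected_clause_if_covering_literal[OF \<open>wf_clause D2\<close>, of K']) (auto simp: D2_def K'_def)
  ultimately have D2: "D2 \<in> Hc"
    by (simp add: Hc_def)
  have "tvars (lits D1) \<subseteq> X"
    using X(3) set_xs by (auto simp: D1_def K_def)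
  then have "tvars (lits D1) \<inter> tvars (lits D2) = {}"
    using tv2 N by fastforce
  moreover have "pvars (lits D1) \<inter> pvars (lits D2) = {}"
    using disj pv by (auto simp: D1_def D2_def K_def K'_def pvars_subst \<delta>_def)
  ultimately have vd: "vars_disjoint D1 D2"
    by (simp add: vars_disjoint_def)
  have id: "snd \<sigma> x = x" if "x \<in> X" for x
    using N[OF that] by (auto simp: \<sigma>_def)
  have fst_\<sigma>: "fst \<sigma> Q = Q" if "Q \<in> pvars (lits (Clause h R))" for Q
    using that pv(3) by (auto simp: \<sigma>_def)
  have unshift: "snd \<sigma> (x + N) = x" if "x \<in> X" for x
    using that by (simp add: \<sigma>_def)
  have "is_unifier \<sigma> K K'"
    using P(1) P'(1) pv(4) id unshift set_xs
    by (auto simp: is_unifier_def is_subst_def subst_lit_def K_def K'_def \<sigma>_def)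
  \<comment> \<open>Any unifier already identifies \<open>P\<close> with \<open>P'\<close> and each
    \<open>x\<close> in \<open>X\<close> with \<open>x + N\<close>, so applying
    \<open>\<sigma>\<close> first makes no difference.\<close>
  moreover have "subst_comp \<theta> \<sigma> = \<theta>" if "is_unifier \<theta> K K'" for \<theta>
  proof -
    have \<theta>: "fst \<theta> P = fst \<theta> P'" "\<forall>x\<in>X. snd \<theta> x = snd \<theta> (x + N)"
      using that set_xs by (auto simp: is_unifier_def subst_lit_def K_def K'_def)
    have "fst \<theta> \<circ> fst \<sigma> = fst \<theta>"
      using \<theta>(1) by (auto simp: \<sigma>_def)
    moreover have "snd \<theta> \<circ> snd \<sigma> = snd \<theta>"
      using \<theta>(2) by (auto simp: \<sigma>_def fun_eq_iff)
    ultimately show ?thesis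
      by (simp add: subst_comp_def)
  qed
  ultimately have mgu: "is_mgu \<sigma> K K'"
    by (rule is_mgu_if_idempotent)
  have rest: "subst_clause \<sigma> (Clause h R) = Clause h R"
    using X(3) id by (subst subst_clause_cong[of _ _ "(id, id)"]) (auto simp: fst_\<sigma>)
  have "subst_lit \<sigma> (subst_lit \<delta> L) = L" if "L \<in># B" for L
  proof -
    have "pred L \<noteq> P'" "set (args L) \<subseteq> X"
      using that pv(1) X(2) by (auto simp: pvars_def tvars_def)
    then have "fst \<sigma> (pred L) = pred L" "map (\<lambda>x. snd \<sigma> (x + N)) (args L) = args L"
      using unshift by (simp add: \<sigma>_def, intro map_idI) auto
    then show ?thesis
      by (simp add: subst_lit_def \<delta>_def comp_def)
  qed
  then have "image_mset (subst_lit \<sigma>) (image_mset (subst_lit \<delta>) B) = B"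
    by (simp add: multiset.map_comp comp_def cong: image_mset_cong)
  with rest have "?C = subst_clause \<sigma> (Clause h (R + image_mset (subst_lit \<delta>) B))"
    by (simp add: subst_clause_def add.commute)
  with mgu have "resolvent_on_body_of_first D1 D2 ?C"
    unfolding resolvent_on_body_of_first_def
    by (intro exI[of _ K] exI[of _ K'] exI[of _ \<sigma>]) (simp add: D1_def D2_def)
  with vd have "sld_resolvent D1 D2 ?C"
    by (simp add: sld_resolvent_def)
  with D1 D2 show thesis
    by (rule that) (simp_all add: D1_def D2_def body_size_def)
qed

theorem mainTheorem5: "reducible (most_general Hc) 2"
  unfolding reducible_def
proof (intro ballI impI)
  fix C
  assume C: "C \<in> most_general Hc" and size: "2 < body_size C"
  \<comment> \<open>The premises will have body sizes \<open>n + 1\<close> and 2. Both are at most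
    \<open>n + 1\<close> because \<open>n\<close> is positive, so \<open>b' = Suc n\<close>
    works.\<close>
  obtain n where "size (body C) = Suc (Suc n)" and n: "0 < n"
    using size by (auto simp: body_size_def less_iff_Suc_add numeral_2_eq_2)
  then obtain h L1 L2 R where C_eq: "C = Clause h (add_mset L1 (add_mset L2 R))" and R: "size R = n"
    by (metis clause.exhaust_sel size_eq_Suc_imp_eq_union size_add_mset Suc_inject)
  have "pred L1 \<notin> pvars (lits (Clause h R))" "pred L2 \<notin> pvars (lits (Clause h R))"
    using C most_general_Hc_pred_unique[of h L1 "add_mset L2 R"]
      most_general_Hc_pred_unique[of h L2 "add_mset L1 R"]
    by (auto simp: C_eq add_mset_commute)
  then have disj: "pvars {#L1, L2#} \<inter> pvars (lits (Clause h R)) = {}"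
    by (auto simp: pvars_def)
  have C_eq': "C = Clause h ({#L1, L2#} + R)"
    by (simp add: C_eq)
  with C have "Clause h ({#L1, L2#} + R) \<in> Hc"
    by (simp add: most_general_def)
  from sld_resolvent_split[OF this disj]
  obtain D1 D2 where D: "D1 \<in> Hc" "D2 \<in> Hc" "sld_resolvent D1 D2 C"
    and sz: "body_size D1 = Suc n" "body_size D2 = 2"
    by (auto simp: R C_eq' numeral_2_eq_2)
  obtain G1 where G1: "G1 \<in> most_general Hc" "instance_of D1 G1"
    using exists_most_general[OF D(1)] .
  obtain G2 where G2: "G2 \<in> most_general Hc" "instance_of D2 G2"
    using exists_most_general[OF D(2)] .
  have "sld_inference G1 G2 C"
    unfolding sld_inference_def using G1(2) G2(2) D(3) variant_of_refl by blast
  moreover have "G1 \<in> bounded_fragment (most_general Hc) \<infinity> (enat (Suc n))"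
    "G2 \<in> bounded_fragment (most_general Hc) \<infinity> (enat (Suc n))"
    using G1 G2 n sz body_size_instance_of[OF G1(2)] body_size_instance_of[OF G2(2)]
    by (simp_all add: bounded_fragment_def)
  moreover have "Suc n < body_size C"
    by (simp add: C_eq body_size_def R)
  ultimately show "\<exists>b'<body_size C. \<exists>C\<^sub>1\<in>bounded_fragment (most_general Hc) \<infinity> (enat b').
      \<exists>C\<^sub>2\<in>bounded_fragment (most_general Hc) \<infinity> (enat b'). sld_inference C\<^sub>1 C\<^sub>2 C"
    by blast
qed

end
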